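(* Let $L_0$ and $L$ be complete distributive lattices, each with more than one element, each having the Decomposition Property $DP$ and satisfying condition $(\mathfrak{M})$. Then $L_0\in E(L)$ if and only if there exists a monotonic operator $G$ on the poset $M(L)$ such that $L_0\cong F_{M(L)/G}$.
   Context: For a complete lattice $L$ with top $1_L$, an element $a\in L$ is completely meet-irreducible if $a\neq 1_L$ and, for every family $\{x_i\mid i\in I\}\subseteq L$, $a=\bigwedge_{i\in I}x_i$ implies $a=x_i$ for some $i\in I$. $M(L)$ is the set of all completely meet-irreducible elements of $L$, with the order induced from $L$. $L$ has $DP$ if every $a\in L$ can be written as $a=\bigwedge Q$ for some $Q\subseteq M(L)$ (with $\bigwedge\emptyset=1_L$). $L$ satisfies $(\mathfrak{M})$ if for every $q\in M(L)$ and every $C\subseteq M(L)$, $q\ge\bigwedge C$ implies $q\ge p$ for some $p\in C$. For a complete lattice $L$, $E(L)$ is the collection of all (complete) lattices $K$ that can be embedded into $L$ by an injective map preserving all infima, all suprema, the top element and the bottom element. An up-set of a poset $X$ is a subset $U\subseteq X$ (possibly empty) such that $x\in U$, $y\in X$, $x\le y$ imply $y\in U$. $\mathcal{F}_X$ is the family of all up-sets of $X$ and $F_X=(\mathcal{F}_X,\supseteq)$ (so $U\le V$ iff $U\supseteq V$). A monotonic operator on a poset $X$ is a function $G:X\to\mathcal{P}(X)$ (power set of $X$) such that for all $x,y\in X$, $x\le y$ implies $G(x)\supseteq G(y)$. Given such $G$, define $x\sim y$ iff $G(x)=G(y)$; $X/G$ denotes the set of equivalence classes $X/{\sim}$, partially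 ordered by $[x]\le[y]$ iff $G(x)\supseteq G(y)$. *)

theory Defs
  imports Main
begin

definition completely_meet_irreducible :: "'a::complete_lattice \<Rightarrow> bool" where
  "completely_meet_irreducible a \<longleftrightarrow> a \<noteq> top \<and> (\<forall>X. a = Inf X \<longrightarrow> a \<in> X)"

(* M(L): a complete lattice L is the universe of a type, and M(L) carries the restriction
   of its order. *)
definition cmi :: "'a::complete_lattice set" where
  "cmi = {a. completely_meet_irreducible a}"

definition has_DP :: "'a::complete_lattice itself \<Rightarrow> bool" where
  "has_DP L \<longleftrightarrow> (\<forall>a::'a. \<exists>Q \<subseteq> cmi. a = Inf Q)"

definition condition_M :: "'a::complete_lattice itself \<Rightarrow> bool" where
  "condition_M L \<longleftrightarrow>
    (\<forall>q \<in> (cmi :: 'a set). \<forall>C \<subseteq> cmi. Inf C \<le> q \<longrightarrow> (\<exists>p \<in> C. p \<le> q))"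

definition complete_embedding ::
  "('a::complete_lattice \<Rightarrow> 'b::complete_lattice) \<Rightarrow> bool" where
  "complete_embedding f \<longleftrightarrow> inj f \<and>
    (\<forall>A. f (Inf A) = Inf (f ` A)) \<and> (\<forall>A. f (Sup A) = Sup (f ` A)) \<and>
    f top = top \<and> f bot = bot"

(* in_E K L renders K \<in> E(L). *)
definition in_E :: "'a::complete_lattice itself \<Rightarrow> 'b::complete_lattice itself \<Rightarrow> bool" where
  "in_E K L \<longleftrightarrow> (\<exists>f :: 'a \<Rightarrow> 'b. complete_embedding f)"

(* From here on a poset is a carrier set X with an order predicate le; only the restriction of
   le to X matters. *)

definition up_sets :: "'a set \<Rightarrow> ('a \<Rightarrow> 'a \<Rightarrow> bool) \<Rightarrow> 'a set set" where
  "up_sets X le = {U. U \<subseteq> X \<and> (\<forall>x \<in> U. \<forall>y \<in> X. le x y \<longrightarrow> y \<in> U)}"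

definition order_isomorphic ::
  "'a set \<Rightarrow> ('a \<Rightarrow> 'a \<Rightarrow> bool) \<Rightarrow> 'b set \<Rightarrow> ('b \<Rightarrow> 'b \<Rightarrow> bool) \<Rightarrow> bool" where
  "order_isomorphic X leX Y leY \<longleftrightarrow>
    (\<exists>f. bij_betw f X Y \<and> (\<forall>x \<in> X. \<forall>y \<in> X. leX x y \<longleftrightarrow> leY (f x) (f y)))"

definition monotonic_operator ::
  "'a set \<Rightarrow> ('a \<Rightarrow> 'a \<Rightarrow> bool) \<Rightarrow> ('a \<Rightarrow> 'a set) \<Rightarrow> bool" where
  "monotonic_operator X le G \<longleftrightarrow> (\<forall>x \<in> X. G x \<subseteq> X) \<and> monotone_on X le (\<supseteq>) G"

definition op_rel :: "'a set \<Rightarrow> ('a \<Rightarrow> 'a set) \<Rightarrow> ('a \<times> 'a) set" where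
  "op_rel X G = {(x, y). x \<in> X \<and> y \<in> X \<and> G x = G y}"

definition op_quotient :: "'a set \<Rightarrow> ('a \<Rightarrow> 'a set) \<Rightarrow> 'a set set" where
  "op_quotient X G = X // op_rel X G"

definition op_quotient_le :: "('a \<Rightarrow> 'a set) \<Rightarrow> 'a set \<Rightarrow> 'a set \<Rightarrow> bool" where
  "op_quotient_le G A B \<longleftrightarrow> (\<exists>x \<in> A. \<exists>y \<in> B. G x \<supseteq> G y)"

(* The order on classes does not depend on the chosen representatives. *)
lemma op_quotient_le_class:
  assumes "x \<in> X" "y \<in> X"
  shows "op_quotient_le G (op_rel X G `` {x}) (op_rel X G `` {y}) \<longleftrightarrow> G x \<supseteq> G y"
  using assms by (auto simp: op_quotient_le_def op_rel_def)

end

theory Submission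
  imports Defs
begin

text \<open>
  In a lattice \<open>L\<close> with \<open>DP\<close> and \<open>(\<MM>)\<close>, an element is determined by the completely
  meet-irreducible elements above it. For \<open>q\<close> in \<open>M(L)\<close>, a join lies below \<open>q\<close> iff all its
  members do, as in every lattice, and a meet lies below \<open>q\<close> iff one of its members does
  (\<open>Inf_le_cmi_iff\<close>). So \<open>L\<close> is a lattice of up-sets of \<open>M(L)\<close> with meet = union and
  join = intersection, and both directions of the theorem reduce to computations with the
  relation \<open>a \<le> q\<close>.

  A complete embedding \<open>f\<close> of \<open>K\<close> preserves joins, so it has an upper adjoint \<open>h\<close>. Two points
  \<open>p\<close>, \<open>q\<close> of \<open>M(L)\<close> cannot be told apart by the image of \<open>f\<close> exactly when \<open>h p = h q\<close>. The
  operator \<open>G\<close> encodes \<open>h q\<close> inside \<open>L\<close>, as the set of irreducibles above \<open>f (h q)\<close>, and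
  \<open>k\<close> corresponds to the up-set of the classes of those \<open>q\<close> with \<open>f k \<le> q\<close>. Every up-set \<open>U\<close>
  arises in this way, from the meet of all \<open>h q\<close> with the class of \<open>q\<close> in \<open>U\<close>.

  Conversely, the projection of \<open>M(L)\<close> onto \<open>M(L)/G\<close> is monotone, so preimages of up-sets are
  up-sets; taking preimages is injective and commutes with unions and intersections. If
  \<open>\<phi>\<close> identifies \<open>K\<close> with the up-sets of \<open>M(L)/G\<close>, sending \<open>k\<close> to the meet of the preimage of
  \<open>\<phi> k\<close> is therefore a complete embedding.
\<close>

section \<open>Elements as up-sets of completely meet-irreducible elements\<close>

lemma le_iff_cmi:
  fixes a b :: "'a::complete_lattice"
  assumes "has_DP TYPE('a)"
  shows "a \<le> b \<longleftrightarrow> (\<forall>q\<in>cmi. b \<le> q \<longrightarrow> a \<le> q)"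
proof
  assume *: "\<forall>q\<in>cmi. b \<le> q \<longrightarrow> a \<le> q"
  obtain Q where Q: "Q \<subseteq> cmi" "b = Inf Q"
    using assms unfolding has_DP_def by blast
  have "a \<le> Inf Q"
    by (rule Inf_greatest) (use * Q Inf_lower in blast)
  then show "a \<le> b" using Q by simp
qed (auto intro: order_trans)

lemma eq_iff_cmi:
  fixes a b :: "'a::complete_lattice"
  assumes "has_DP TYPE('a)"
  shows "a = b \<longleftrightarrow> (\<forall>q\<in>cmi. a \<le> q \<longleftrightarrow> b \<le> q)"
  using le_iff_cmi[OF assms, of a b] le_iff_cmi[OF assms, of b a] by (auto intro: antisym)

text \<open>Condition \<open>(\<MM>)\<close> speaks of meets of irreducible elements only; by \<open>DP\<close> the members of an
  arbitrary meet can be replaced by the irreducibles above them.\<close>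

lemma Inf_le_cmi_iff:
  fixes q :: "'a::complete_lattice"
  assumes DP: "has_DP TYPE('a)" and M: "condition_M TYPE('a)" and q: "q \<in> cmi"
  shows "Inf A \<le> q \<longleftrightarrow> (\<exists>a\<in>A. a \<le> q)"
proof
  assume le: "Inf A \<le> q"
  let ?C = "{p \<in> cmi. \<exists>a\<in>A. a \<le> p}"
  have "Inf ?C \<le> a" if "a \<in> A" for a
    using that by (subst le_iff_cmi[OF DP]) (auto intro: Inf_lower)
  then have "Inf ?C \<le> q"
    using le by (meson Inf_greatest order_trans)
  then obtain p where "p \<in> ?C" "p \<le> q"
    using M q unfolding condition_M_def by (metis (no_types, lifting) mem_Collect_eq subsetI)
  then show "\<exists>a\<in>A. a \<le> q" by (auto intro: order_trans)
qed (auto intro: Inf_lower2)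


section \<open>The quotient by a monotonic operator\<close>

abbreviation op_class :: "'a set \<Rightarrow> ('a \<Rightarrow> 'a set) \<Rightarrow> 'a \<Rightarrow> 'a set" where
  "op_class X G x \<equiv> op_rel X G `` {x}"

lemma op_class_eq_iff:
  assumes "x \<in> X" "y \<in> X"
  shows "op_class X G x = op_class X G y \<longleftrightarrow> G x = G y"
  using assms by (auto simp: op_rel_def)

lemma op_quotient_eq: "op_quotient X G = op_class X G ` X"
  by (auto simp: op_quotient_def quotient_def)

lemma up_sets_quotient_iff:
  "U \<in> up_sets (op_quotient X G) (op_quotient_le G) \<longleftrightarrow>
    U \<subseteq> op_class X G ` X \<and>
    (\<forall>x\<in>X. \<forall>y\<in>X. op_class X G x \<in> U \<longrightarrow> G x \<supseteq> G y \<longrightarrow> op_class X G y \<in> U)"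
  (is "?L \<longleftrightarrow> ?R")
proof
  assume ?L
  then show ?R
    unfolding up_sets_def op_quotient_eq
    by (auto simp: op_quotient_le_class)
next
  assume R: ?R
  have "B \<in> U" if "A \<in> U" "B \<in> op_class X G ` X" "op_quotient_le G A B" for A B
  proof -
    obtain x where x: "x \<in> X" "A = op_class X G x" using R \<open>A \<in> U\<close> by blast
    obtain y where y: "y \<in> X" "B = op_class X G y"
      using \<open>B \<in> op_class X G ` X\<close> by blast
    then have "G x \<supseteq> G y" using that(3) x by (simp add: op_quotient_le_class)
    then show ?thesis using R x y \<open>A \<in> U\<close> by blast
  qed
  then show ?L using R unfolding up_sets_def op_quotient_eq by auto
qed


section \<open>From a complete embedding to a monotonic operator\<close>

definition upper_adjoint :: "('a::complete_lattice \<Rightarrow> 'b::complete_lattice) \<Rightarrow> 'b \<Rightarrow> 'a" where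
  "upper_adjoint f q = Sup {k. f k \<le> q}"

lemma complete_embedding_le_iff:
  assumes "complete_embedding f"
  shows "f x \<le> f y \<longleftrightarrow> x \<le> y"
proof -
  have inj: "inj f" and "f (Sup {x, y}) = Sup (f ` {x, y})"
    using assms unfolding complete_embedding_def by blast+
  then have "f (sup x y) = sup (f x) (f y)" by simp
  then show ?thesis using inj by (metis injD le_iff_sup sup_commute)
qed

lemma le_upper_adjoint_iff:
  assumes "complete_embedding f"
  shows "k \<le> upper_adjoint f q \<longleftrightarrow> f k \<le> q"
proof
  assume "k \<le> upper_adjoint f q"
  then have "f k \<le> f (upper_adjoint f q)"
    by (simp add: complete_embedding_le_iff[OF assms])
  also have "\<dots> = Sup (f ` {k. f k \<le> q})"
    using assms unfolding complete_embedding_def upper_adjoint_def by blast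
  also have "\<dots> \<le> q" by (rule Sup_least) auto
  finally show "f k \<le> q" .
qed (auto simp: upper_adjoint_def intro: Sup_upper)

text \<open>The elements \<open>h q\<close> live in \<open>K\<close>, but \<open>G\<close> has to take subsets of \<open>M(L)\<close> as values. Since
  \<open>f\<close> reflects the order and elements of \<open>L\<close> are determined by the irreducibles above them,
  the irreducibles above \<open>f (h q)\<close> carry the same information as \<open>h q\<close>.\<close>

definition adjoint_operator ::
  "('a::complete_lattice \<Rightarrow> 'b::complete_lattice) \<Rightarrow> 'b \<Rightarrow> 'b set" where
  "adjoint_operator f q = {p \<in> cmi. f (upper_adjoint f q) \<le> p}"

lemma adjoint_operator_supset_iff:
  fixes f :: "'a::complete_lattice \<Rightarrow> 'b::complete_lattice"
  assumes DP: "has_DP TYPE('b)" and f: "complete_embedding f"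
  shows "adjoint_operator f p \<supseteq> adjoint_operator f q \<longleftrightarrow> upper_adjoint f p \<le> upper_adjoint f q"
  using complete_embedding_le_iff[OF f, of "upper_adjoint f p" "upper_adjoint f q"]
    le_iff_cmi[OF DP, of "f (upper_adjoint f p)" "f (upper_adjoint f q)"]
  by (auto simp: adjoint_operator_def)

lemma monotonic_adjoint_operator:
  fixes f :: "'a::complete_lattice \<Rightarrow> 'b::complete_lattice"
  assumes DP: "has_DP TYPE('b)" and f: "complete_embedding f"
  shows "monotonic_operator cmi (\<le>) (adjoint_operator f)"
proof -
  have "upper_adjoint f p \<le> upper_adjoint f q" if "p \<le> q" for p q
    using that le_upper_adjoint_iff[OF f] by (meson order_refl order_trans)
  then show ?thesis
    unfolding monotonic_operator_def monotone_on_def adjoint_operator_supset_iff[OF DP f]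
    by (auto simp: adjoint_operator_def)
qed

text \<open>For \<open>q\<close> in \<open>M(L)\<close>, the condition \<open>f k \<le> q\<close> amounts to \<open>k \<le> h q\<close> and hence depends only on
  the class of \<open>q\<close>; this is why passing to classes loses nothing.\<close>

lemma order_isomorphic_adjoint_quotient:
  fixes f :: "'a::complete_lattice \<Rightarrow> 'b::complete_lattice"
  assumes DP: "has_DP TYPE('b)" and M: "condition_M TYPE('b)" and f: "complete_embedding f"
  defines "G \<equiv> adjoint_operator f"
  shows "order_isomorphic (UNIV :: 'a set) (\<le>)
    (up_sets (op_quotient cmi G) (op_quotient_le G)) (\<supseteq>)"
proof -
  define h where "h = upper_adjoint f"
  define \<psi> where "\<psi> k = op_class cmi G ` {q \<in> cmi. f k \<le> q}" for k
  have adj: "f k \<le> q \<longleftrightarrow> k \<le> h q" for k q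
    by (simp add: h_def le_upper_adjoint_iff[OF f])
  have G_le: "G p \<supseteq> G q \<longleftrightarrow> h p \<le> h q" for p q
    by (simp only: G_def h_def adjoint_operator_supset_iff[OF DP f])
  have mem: "op_class cmi G p \<in> \<psi> k \<longleftrightarrow> f k \<le> p" if "p \<in> cmi" for p k
  proof
    assume "op_class cmi G p \<in> \<psi> k"
    then obtain q where q: "q \<in> cmi" "f k \<le> q" "op_class cmi G p = op_class cmi G q"
      by (auto simp: \<psi>_def)
    then have "G p = G q" using op_class_eq_iff that by metis
    then have "h q \<le> h p" using G_le[where p = q and q = p] by simp
    moreover have "k \<le> h q" using q adj by simp
    ultimately show "f k \<le> p" unfolding adj by (rule order_trans[rotated])
  qed (use that in \<open>auto simp: \<psi>_def\<close>)
  have order: "k \<le> k' \<longleftrightarrow> \<psi> k \<supseteq> \<psi> k'" for k k'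
  proof -
    have "k \<le> k' \<longleftrightarrow> (\<forall>q\<in>cmi. f k' \<le> q \<longrightarrow> f k \<le> q)"
      unfolding complete_embedding_le_iff[OF f, symmetric, of k k'] by (rule le_iff_cmi[OF DP])
    also have "\<dots> \<longleftrightarrow> (\<forall>q\<in>cmi. op_class cmi G q \<in> \<psi> k' \<longrightarrow> op_class cmi G q \<in> \<psi> k)"
      by (simp add: mem)
    also have "\<dots> \<longleftrightarrow> \<psi> k \<supseteq> \<psi> k'"
      by (auto simp: \<psi>_def)
    finally show ?thesis .
  qed
  have range: "\<psi> k \<in> up_sets (op_quotient cmi G) (op_quotient_le G)" for k
    unfolding up_sets_quotient_iff
  proof (intro conjI ballI impI)
    show "\<psi> k \<subseteq> op_class cmi G ` cmi" by (auto simp: \<psi>_def)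
  next
    fix x y assume "x \<in> cmi" "y \<in> cmi" "op_class cmi G x \<in> \<psi> k" "G x \<supseteq> G y"
    then have "h x \<le> h y" "k \<le> h x" "y \<in> cmi" by (simp_all add: mem adj G_le)
    then show "op_class cmi G y \<in> \<psi> k" by (simp add: mem adj)
  qed
  have surj: "\<exists>k. U = \<psi> k"
    if U: "U \<in> up_sets (op_quotient cmi G) (op_quotient_le G)" for U
  proof -
    define Q where "Q = {q \<in> cmi. op_class cmi G q \<in> U}"
    define k where "k = Inf (h ` Q)"
    have U_sub: "U \<subseteq> op_class cmi G ` cmi"
      using U unfolding up_sets_quotient_iff by blast
    have U_up: "op_class cmi G p \<in> U"
      if "q \<in> cmi" "p \<in> cmi" "op_class cmi G q \<in> U" "h q \<le> h p" for p q
      using U that unfolding up_sets_quotient_iff G_le by blast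
    have "f k = Inf (f ` h ` Q)"
      using f unfolding complete_embedding_def k_def by blast
    then have "f k \<le> p \<longleftrightarrow> (\<exists>q\<in>Q. h q \<le> h p)" if "p \<in> cmi" for p
      by (simp add: Inf_le_cmi_iff[OF DP M that] adj)
    moreover have "(\<exists>q\<in>Q. h q \<le> h p) \<longleftrightarrow> op_class cmi G p \<in> U" if "p \<in> cmi" for p
      using that U_up unfolding Q_def by blast
    ultimately have "op_class cmi G p \<in> \<psi> k \<longleftrightarrow> op_class cmi G p \<in> U" if "p \<in> cmi" for p
      using that mem by metis
    moreover have "\<psi> k \<subseteq> op_class cmi G ` cmi"
      by (auto simp: \<psi>_def)
    ultimately have "U = \<psi> k" using U_sub by blast
    then show ?thesis ..
  qed
  have "inj \<psi>" using order by (metis injI order_antisym subset_refl)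
  then have "bij_betw \<psi> UNIV (up_sets (op_quotient cmi G) (op_quotient_le G))"
    using range surj unfolding bij_betw_def by blast
  then show ?thesis using order unfolding order_isomorphic_def by blast
qed


section \<open>From a monotonic operator to a complete embedding\<close>

lemma up_sets_Union: "\<U> \<subseteq> up_sets X le \<Longrightarrow> \<Union>\<U> \<in> up_sets X le"
  unfolding up_sets_def by blast

lemma up_sets_Inter: "\<U> \<subseteq> up_sets X le \<Longrightarrow> X \<inter> \<Inter>\<U> \<in> up_sets X le"
  unfolding up_sets_def by blast

text \<open>An order isomorphism preserves all bounds that exist, and the bounds in a lattice of
  up-sets are unions and intersections. The intersection is taken inside \<open>X\<close> so that the empty
  join, the bottom element, is \<open>X\<close>.\<close>

lemma up_sets_iso_Inf_Sup:
  fixes \<phi> :: "'a::complete_lattice \<Rightarrow> 'b set"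
  assumes bij: "bij_betw \<phi> UNIV (up_sets X le)"
    and order: "\<And>x y. x \<le> y \<longleftrightarrow> \<phi> x \<supseteq> \<phi> y"
  shows "\<phi> (Inf A) = \<Union>(\<phi> ` A)" and "\<phi> (Sup A) = X \<inter> \<Inter>(\<phi> ` A)"
proof -
  have in_up: "\<phi> x \<in> up_sets X le" for x
    using bij unfolding bij_betw_def by blast
  then have up: "\<phi> ` A \<subseteq> up_sets X le" by blast
  obtain i where i: "\<phi> i = \<Union>(\<phi> ` A)"
    using up_sets_Union[OF up] bij unfolding bij_betw_def by (metis imageE)
  have "i = Inf A"
  proof (rule antisym)
    show "i \<le> Inf A" by (rule Inf_greatest) (use i order in blast)
    have "\<phi> a \<subseteq> \<phi> (Inf A)" if "a \<in> A" for a
      using that Inf_lower order by blast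
    then show "Inf A \<le> i" unfolding order i by blast
  qed
  then show "\<phi> (Inf A) = \<Union>(\<phi> ` A)" using i by simp
  obtain s where s: "\<phi> s = X \<inter> \<Inter>(\<phi> ` A)"
    using up_sets_Inter[OF up] bij unfolding bij_betw_def by (metis imageE)
  have "s = Sup A"
  proof (rule antisym)
    show "Sup A \<le> s" by (rule Sup_least) (use s order in blast)
    have "\<phi> (Sup A) \<subseteq> \<phi> a" if "a \<in> A" for a
      using that Sup_upper order by blast
    moreover have "\<phi> (Sup A) \<subseteq> X" using in_up[of "Sup A"] unfolding up_sets_def by blast
    ultimately show "s \<le> Sup A" unfolding order s by blast
  qed
  then show "\<phi> (Sup A) = X \<inter> \<Inter>(\<phi> ` A)" using s by simp
qed

lemma complete_embedding_from_operator:
  fixes G :: "'b::complete_lattice \<Rightarrow> 'b set"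
  assumes DP: "has_DP TYPE('b)" and M: "condition_M TYPE('b)"
    and G: "monotonic_operator cmi (\<le>) G"
    and iso: "order_isomorphic (UNIV :: 'a::complete_lattice set) (\<le>)
      (up_sets (op_quotient cmi G) (op_quotient_le G)) (\<supseteq>)"
  shows "\<exists>f :: 'a \<Rightarrow> 'b. complete_embedding f"
proof -
  let ?c = "op_class cmi G"
  obtain \<phi> :: "'a \<Rightarrow> 'b set set" where
    bij: "bij_betw \<phi> UNIV (up_sets (op_quotient cmi G) (op_quotient_le G))"
    and order: "\<And>x y. x \<le> y \<longleftrightarrow> \<phi> x \<supseteq> \<phi> y"
    using iso unfolding order_isomorphic_def by blast
  note \<phi>_Inf = up_sets_iso_Inf_Sup(1)[OF bij order]
    and \<phi>_Sup = up_sets_iso_Inf_Sup(2)[OF bij order]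
  have \<phi>_up: "\<phi> k \<in> up_sets (op_quotient cmi G) (op_quotient_le G)" for k
    using bij unfolding bij_betw_def by blast
  define f where "f k = Inf {q \<in> cmi. ?c q \<in> \<phi> k}" for k
  have mem: "f k \<le> p \<longleftrightarrow> ?c p \<in> \<phi> k" if p: "p \<in> cmi" for k p
  proof -
    have "?c p \<in> \<phi> k" if "q \<in> cmi" "?c q \<in> \<phi> k" "q \<le> p" for q
    proof -
      have "G q \<supseteq> G p"
        using G that p unfolding monotonic_operator_def monotone_on_def by blast
      then show ?thesis using \<phi>_up[of k] that p unfolding up_sets_quotient_iff by blast
    qed
    then show ?thesis using p by (auto simp: f_def Inf_le_cmi_iff[OF DP M p])
  qed
  have Inf: "f (Inf A) = Inf (f ` A)" for A
    by (simp add: eq_iff_cmi[OF DP] mem \<phi>_Inf Inf_le_cmi_iff[OF DP M])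
  have Sup: "f (Sup A) = Sup (f ` A)" for A
    by (simp add: eq_iff_cmi[OF DP] mem \<phi>_Sup Sup_le_iff op_quotient_eq)
  have "inj f"
  proof (rule injI)
    fix x y assume "f x = f y"
    then have "?c p \<in> \<phi> x \<longleftrightarrow> ?c p \<in> \<phi> y" if "p \<in> cmi" for p
      using mem[OF that] by metis
    moreover have "\<phi> x \<subseteq> ?c ` cmi" "\<phi> y \<subseteq> ?c ` cmi"
      using \<phi>_up unfolding up_sets_quotient_iff by blast+
    ultimately have "\<phi> x = \<phi> y" by blast
    then show "x = y" using bij unfolding bij_betw_def by (meson UNIV_I inj_onD)
  qed
  then have "complete_embedding f"
    using Inf Sup Inf[of "{}"] Sup[of "{}"] unfolding complete_embedding_def by simp
  then show ?thesis by blast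
qed

theorem theorem4p2:
  assumes "\<exists>x y :: 'k::{complete_lattice, distrib_lattice}. x \<noteq> y"
    and "\<exists>x y :: 'l::{complete_lattice, distrib_lattice}. x \<noteq> y"
    and "has_DP TYPE('k)" and "condition_M TYPE('k)"
    and "has_DP TYPE('l)" and "condition_M TYPE('l)"
  shows "in_E TYPE('k) TYPE('l) \<longleftrightarrow>
    (\<exists>G :: 'l \<Rightarrow> 'l set. monotonic_operator cmi (\<le>) G \<and>
      order_isomorphic (UNIV :: 'k set) (\<le>)
        (up_sets (op_quotient cmi G) (op_quotient_le G)) (\<supseteq>))"
proof
  assume "in_E TYPE('k) TYPE('l)"
  then obtain f :: "'k \<Rightarrow> 'l" where "complete_embedding f"
    unfolding in_E_def by blast
  then show "\<exists>G :: 'l \<Rightarrow> 'l set. monotonic_operator cmi (\<le>) G \<and>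
      order_isomorphic (UNIV :: 'k set) (\<le>)
        (up_sets (op_quotient cmi G) (op_quotient_le G)) (\<supseteq>)"
    using monotonic_adjoint_operator order_isomorphic_adjoint_quotient assms(5,6) by blast
next
  assume "\<exists>G :: 'l \<Rightarrow> 'l set. monotonic_operator cmi (\<le>) G \<and>
      order_isomorphic (UNIV :: 'k set) (\<le>)
        (up_sets (op_quotient cmi G) (op_quotient_le G)) (\<supseteq>)"
  then show "in_E TYPE('k) TYPE('l)"
    using complete_embedding_from_operator[OF assms(5,6)] unfolding in_E_def by blast
qed

end
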